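(* Let $(x_n)_{n\ge 1}$ be a sequence in $[0,1)$ with Poissonian pair correlations. For each integer $n\ge 2$, let $\ell_{n,1}<\cdots<\ell_{n,g(n)}$ be the distinct gap lengths between neighboring elements of $x_1,\ldots,x_n$ on the torus, and let $\varphi_{n,i}$ be the number of gaps of length $\ell_{n,i}$. Then $$\max_{1\le i\le g(n)} \varphi_{n,i}=o(n)\qquad\text{as } n\to\infty,$$ that is, there are no strictly increasing sequence $(n_t)$ of indexes and constant $c>0$ such that, for every $t$, $\varphi_{n_t,i}\ge c\,n_t$ for at least one $i\in\{1,\ldots,g(n_t)\}$.
   Context: The torus is identified with $[0,1)$, and $|\cdot|$ applied to a difference of two points denotes the distance from the nearest integer (so $|z|=\min(z,1-z)$ for $z\in[0,1)$). A sequence $x=(x_n)_{n\ge1}$ in $[0,1)$ has Poissonian pair correlations if for every real $s>0$, $$\lim_{N\to\infty} F_{x,N}(s)=2s,\qquad\text{where } F_{x,N}(s):=\frac1N\#\left\{1\le i\neq j\le N: |x_i-x_j|<\frac sN\right\},$$ the count being over ordered pairs $(i,j)$ with $i\ne j$. Gap lengths: for an integer $N\ge2$, let $\sigma$ be a permutation of $\{1,\ldots,N\}$ with $x_{\sigma(1)}\le\cdots\le x_{\sigma(N)}$, and set $\sigma(N+1):=\sigma(1)$. The set of different gap lengths is $$G(N):=\{r\in[0,1): r=|x_{\sigma(k+1)}-x_{\sigma(k)}|\text{ for some }k=1,\ldots,N\},$$ and $g(N):=\#G(N)$. The elements of $G(N)$ in increasing order are $\ell_{N,1}<\cdots<\ell_{N,g(N)}$,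 and for $i=1,\ldots,g(N)$, $$\varphi_{N,i}:=\#\{j\in\{1,\ldots,N\}: |x_{\sigma(j+1)}-x_{\sigma(j)}|=\ell_{N,i}\}.$$ *)

theory Defs
  imports
    "HOL-Analysis.Analysis"
    "HOL-Combinatorics.Permutations"
    "HOL-Library.Landau_Symbols"
begin

text \<open>
  Sequences $(x_n)_{n \ge 1}$ are functions on \<^typ>\<open>nat\<close>; only the values at arguments
  $\ge 1$ are ever used.
\<close>

text \<open>Distance from the nearest integer.\<close>

definition torus_norm :: "real \<Rightarrow> real" where
  "torus_norm z = \<bar>z - of_int (round z)\<bar>"

lemma torus_norm_eq_min:
  assumes "0 \<le> z" "z < 1"
  shows "torus_norm z = min z (1 - z)"
proof (cases "z < 1/2")
  case True
  then have "round z = 0"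
    using assms by (intro round_unique') auto
  then show ?thesis
    using True assms by (simp add: torus_norm_def)
next
  case False
  then have "round z = 1"
    using assms by (intro round_unique) auto
  then show ?thesis
    using False assms by (simp add: torus_norm_def)
qed

definition pair_corr :: "(nat \<Rightarrow> real) \<Rightarrow> nat \<Rightarrow> real \<Rightarrow> real" where
  "pair_corr x N s =
     1 / real N * real (card {(i, j). i \<in> {1..N} \<and> j \<in> {1..N} \<and> i \<noteq> j \<and>
                                      torus_norm (x i - x j) < s / real N})"

definition poissonian_pair_correlations :: "(nat \<Rightarrow> real) \<Rightarrow> bool" where
  "poissonian_pair_correlations x \<longleftrightarrow>
     (\<forall>s>0. (\<lambda>N. pair_corr x N s) \<longlonglongrightarrow> 2 * s)"

text \<open>
  Ordering the first $N$ points need not be unique (there may be ties), so the sorting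
  permutation \<open>\<sigma>\<close> is an explicit parameter of everything that is built from it.
\<close>

definition sorting_perm :: "(nat \<Rightarrow> real) \<Rightarrow> nat \<Rightarrow> (nat \<Rightarrow> nat) \<Rightarrow> bool" where
  "sorting_perm x N \<sigma> \<longleftrightarrow> \<sigma> permutes {1..N} \<and> mono_on {1..N} (\<lambda>k. x (\<sigma> k))"

text \<open>The function update is the convention $\sigma(N+1) := \sigma(1)$.\<close>

definition gap :: "(nat \<Rightarrow> real) \<Rightarrow> nat \<Rightarrow> (nat \<Rightarrow> nat) \<Rightarrow> nat \<Rightarrow> real" where
  "gap x N \<sigma> k = (let \<tau> = \<sigma>(N + 1 := \<sigma> 1) in torus_norm (x (\<tau> (k + 1)) - x (\<tau> k)))"

definition gap_lengths :: "(nat \<Rightarrow> real) \<Rightarrow> nat \<Rightarrow> (nat \<Rightarrow> nat) \<Rightarrow> real set" where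
  "gap_lengths x N \<sigma> = {r \<in> {0..<1}. \<exists>k\<in>{1..N}. r = gap x N \<sigma> k}"

definition num_gap_lengths :: "(nat \<Rightarrow> real) \<Rightarrow> nat \<Rightarrow> (nat \<Rightarrow> nat) \<Rightarrow> nat" where
  "num_gap_lengths x N \<sigma> = card (gap_lengths x N \<sigma>)"

text \<open>
  The \<open>i\<close>-th smallest gap length, meaningful for $1 \le i \le g(N)$; list positions start
  at \<open>0\<close>, whence \<open>i - 1\<close>.
\<close>

definition nth_gap_length :: "(nat \<Rightarrow> real) \<Rightarrow> nat \<Rightarrow> (nat \<Rightarrow> nat) \<Rightarrow> nat \<Rightarrow> real" where
  "nth_gap_length x N \<sigma> i = sorted_list_of_set (gap_lengths x N \<sigma>) ! (i - 1)"

definition gap_count :: "(nat \<Rightarrow> real) \<Rightarrow> nat \<Rightarrow> (nat \<Rightarrow> nat) \<Rightarrow> nat \<Rightarrow> nat" where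
  "gap_count x N \<sigma> i = card {j \<in> {1..N}. gap x N \<sigma> j = nth_gap_length x N \<sigma> i}"

end

theory Submission
  imports Defs
begin

text \<open>
  If $m$ of the $n$ gaps have the same length $r$, then $m r \le 1$, so $m > \delta n$ forces
  $n r < 1/\delta$. On the other hand these gaps give $m$ ordered pairs at distance exactly $r$,
  all of which are counted by $F_{x,n}(t) - F_{x,n}(s)$ whenever $s \le n r < t$. Since
  $F_{x,n}(s) \to 2s$ simultaneously at the finitely many points of a grid of mesh $\varepsilon$
  covering $[0, 1/\delta]$, this difference is at most $4\varepsilon$ for large $n$.
\<close>

lemma torus_norm_nonneg: "0 \<le> torus_norm z"
  by (simp add: torus_norm_def)

lemma torus_norm_le_dist_int: "torus_norm z \<le> \<bar>z - of_int m\<bar>"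
  unfolding torus_norm_def by (rule round_diff_minimal)

lemma torus_norm_less_1: "torus_norm z < 1"
  using of_int_round_abs_le[of z] by (simp add: torus_norm_def abs_minus_commute)

lemma gap_nonneg: "0 \<le> gap x N \<sigma> k"
  by (simp add: gap_def Let_def torus_norm_nonneg)

lemma gap_less_1: "gap x N \<sigma> k < 1"
  by (simp add: gap_def Let_def torus_norm_less_1)

text \<open>Guarantees that the \<open>Max\<close> in the theorem ranges over a nonempty set. The
  restriction to \<open>{0..<1}\<close> in \<open>gap_lengths\<close> discards nothing, since every
  torus distance lies there.\<close>

lemma num_gap_lengths_pos:
  assumes "N \<ge> 1"
  shows "num_gap_lengths x N \<sigma> \<ge> 1"
proof -
  have eq: "gap_lengths x N \<sigma> = gap x N \<sigma> ` {1..N}"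
    by (auto simp: gap_lengths_def gap_nonneg gap_less_1)
  show ?thesis
    using assms unfolding num_gap_lengths_def eq by (simp add: Suc_le_eq card_gt_0_iff)
qed

text \<open>The differences of neighbors in sorted order telescope, and the wraparound gap fits into
  what remains of the circle. Equality can fail, because a difference larger than 1/2 exceeds its
  torus distance.\<close>

lemma sum_gaps_le_1:
  assumes "N \<ge> 2" and range: "\<And>n. n \<ge> 1 \<Longrightarrow> x n \<in> {0..<1}" and sort: "sorting_perm x N \<sigma>"
  shows "(\<Sum>k = 1..N. gap x N \<sigma> k) \<le> 1"
proof -
  have mono: "x (\<sigma> k) \<le> x (\<sigma> l)" if "1 \<le> k" "k \<le> l" "l \<le> N" for k l
    using sort that by (auto simp: sorting_perm_def mono_on_def)
  have rng: "x (\<sigma> k) \<in> {0..<1}" if "1 \<le> k" "k \<le> N" for k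
  proof -
    have "\<sigma> k \<in> {1..N}"
      using sort that permutes_in_image[of \<sigma> "{1..N}" k] by (simp add: sorting_perm_def)
    then show ?thesis by (intro range) auto
  qed
  have "(\<Sum>k = 1..<N. gap x N \<sigma> k) \<le> (\<Sum>k = 1..<N. x (\<sigma> (Suc k)) - x (\<sigma> k))"
  proof (rule sum_mono)
    fix k assume k: "k \<in> {1..<N}"
    then show "gap x N \<sigma> k \<le> x (\<sigma> (Suc k)) - x (\<sigma> k)"
      using torus_norm_le_dist_int[of "x (\<sigma> (Suc k)) - x (\<sigma> k)" 0] mono[of k "Suc k"]
      by (simp add: gap_def)
  qed
  also have "\<dots> = x (\<sigma> N) - x (\<sigma> 1)"
    using assms(1) by (subst sum_Suc_diff') auto
  finally have inner: "(\<Sum>k = 1..<N. gap x N \<sigma> k) \<le> x (\<sigma> N) - x (\<sigma> 1)" .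
  \<comment> \<open>The wraparound difference lies in (-1, 0], so it is compared with the integer
    -1; \<open>rng\<close> makes the absolute value disappear.\<close>
  have last: "gap x N \<sigma> N \<le> 1 - (x (\<sigma> N) - x (\<sigma> 1))"
    using torus_norm_le_dist_int[of "x (\<sigma> 1) - x (\<sigma> N)" "-1"] rng[of 1] rng[of N] assms(1)
    by (simp add: gap_def)
  have "{1..N} = insert N {1..<N}"
    using assms(1) by auto
  then show ?thesis
    using inner last by simp
qed

lemma card_equal_gaps_mult_le_1:
  assumes "N \<ge> 2" "\<And>n. n \<ge> 1 \<Longrightarrow> x n \<in> {0..<1}" "sorting_perm x N \<sigma>"
  shows "real (card {j \<in> {1..N}. gap x N \<sigma> j = r}) * r \<le> 1"
proof -
  have "real (card {j \<in> {1..N}. gap x N \<sigma> j = r}) * r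
      = (\<Sum>j\<in>{j \<in> {1..N}. gap x N \<sigma> j = r}. gap x N \<sigma> j)"
    by simp
  also have "\<dots> \<le> (\<Sum>k = 1..N. gap x N \<sigma> k)"
    by (rule sum_mono2) (auto simp: gap_nonneg)
  finally show ?thesis
    using sum_gaps_le_1[OF assms] by simp
qed

text \<open>Sending a gap to the ordered pair of its endpoints embeds the gaps of length
  \<open>r\<close> into the pairs at distance less than \<open>t / N\<close> but not less than
  \<open>s / N\<close>.\<close>

lemma card_equal_gaps_le_pair_corr_diff:
  assumes N: "N \<ge> 2" and sort: "sorting_perm x N \<sigma>"
    and s: "s \<le> real N * r" and t: "real N * r < t"
  shows "real (card {j \<in> {1..N}. gap x N \<sigma> j = r}) \<le> real N * (pair_corr x N t - pair_corr x N s)"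
proof -
  define P where "P u = {(i, j). i \<in> {1..N} \<and> j \<in> {1..N} \<and> i \<noteq> j \<and>
                                 torus_norm (x i - x j) < u / real N}" for u
  define J where "J = {j \<in> {1..N}. gap x N \<sigma> j = r}"
  define \<tau> where "\<tau> = \<sigma>(N + 1 := \<sigma> 1)"
  define h where "h k = (\<tau> (k + 1), \<tau> k)" for k
  have perm: "\<sigma> permutes {1..N}"
    using sort by (simp add: sorting_perm_def)
  have \<sigma>_eq: "\<sigma> k = \<sigma> l \<longleftrightarrow> k = l" for k l
    using permutes_inj[OF perm] by (auto simp: inj_def)
  have \<sigma>_in: "\<sigma> k \<in> {1..N} \<longleftrightarrow> k \<in> {1..N}" for k
    using perm by (rule permutes_in_image)
  have fin: "finite (P u)" for u
    by (rule finite_subset[of _ "{1..N} \<times> {1..N}"]) (auto simp: P_def)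
  \<comment> \<open>The second component suffices: on \<open>{1..N}\<close> it is \<sigma>, which is
    injective. For \<open>N = 2\<close> both gaps join the same two points, and only the order tells
    the pairs apart.\<close>
  have inj: "inj_on h J"
    by (auto simp: inj_on_def h_def \<tau>_def J_def \<sigma>_eq split: if_splits)
  have below: "s / real N \<le> r" and above: "r < t / real N"
    using N s t by (simp_all add: field_simps)
  have sub: "P s \<union> h ` J \<subseteq> P t"
  proof
    fix p assume "p \<in> P s \<union> h ` J"
    then show "p \<in> P t"
    proof
      assume "p \<in> P s"
      then show ?thesis using below above by (auto simp: P_def)
    next
      assume "p \<in> h ` J"
      then obtain k where k: "k \<in> {1..N}" "gap x N \<sigma> k = r" "p = h k"
        by (auto simp: J_def)
      \<comment> \<open>At \<open>k = N\<close> the pair is (\<open>\<sigma> 1\<close>,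
        \<open>\<sigma> N\<close>), whose entries differ because \<open>N \<ge> 2\<close>.\<close>
      have "\<tau> (k + 1) \<in> {1..N}" "\<tau> k \<in> {1..N}" "\<tau> (k + 1) \<noteq> \<tau> k"
        using k N \<sigma>_in[of k] \<sigma>_in[of 1] \<sigma>_in[of "k + 1"] by (auto simp: \<tau>_def \<sigma>_eq)
      moreover have "torus_norm (x (\<tau> (k + 1)) - x (\<tau> k)) = r"
        using k by (simp add: gap_def \<tau>_def Let_def)
      ultimately show ?thesis
        using above k by (simp add: P_def h_def)
    qed
  qed
  \<comment> \<open>\<open>P s\<close> asks for a distance strictly below \<open>s / N\<close>, so
    the non-strict \<open>s \<le> N * r\<close> is enough.\<close>
  have disj: "P s \<inter> h ` J = {}"
    using below by (auto simp: P_def h_def J_def gap_def Let_def \<tau>_def split: if_splits)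
  have "card (P s) + card J = card (P s \<union> h ` J)"
    using fin disj inj by (subst card_Un_disjoint) (auto simp: J_def card_image)
  also have "\<dots> \<le> card (P t)"
    using fin sub by (rule card_mono)
  finally have "real (card (P s)) + real (card J) \<le> real (card (P t))"
    by linarith
  moreover have "real N * pair_corr x N u = real (card (P u))" for u
    using N by (simp add: pair_corr_def P_def)
  ultimately show ?thesis
    by (simp add: right_diff_distrib J_def)
qed

text \<open>Supplies the limit at the grid point 0, about which the Poissonian property, stated for
  \<open>s > 0\<close>, says nothing.\<close>

lemma pair_corr_0: "pair_corr x N 0 = 0"
proof -
  have "\<not> torus_norm z < 0" for z
    using torus_norm_nonneg[of z] by simp
  then show ?thesis by (simp add: pair_corr_def)
qed

text \<open>The bound is uniform in \<open>r\<close>: the length may vary with \<open>n\<close>, but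
  \<open>n * r\<close> always falls into one of finitely many grid cells fixed in advance.\<close>

proposition eventually_card_equal_gaps_le:
  assumes range: "\<And>n. n \<ge> 1 \<Longrightarrow> x n \<in> {0..<1}"
    and ppc: "poissonian_pair_correlations x"
    and sort: "\<And>n. n \<ge> 2 \<Longrightarrow> sorting_perm x n (\<sigma> n)"
    and \<delta>: "\<delta> > 0"
  shows "\<forall>\<^sub>F n in sequentially. \<forall>r. real (card {j \<in> {1..n}. gap x n (\<sigma> n) j = r}) \<le> \<delta> * real n"
proof -
  \<comment> \<open>Over one cell the limit \<open>2 * s\<close> grows by
    \<open>2 * \<epsilon>\<close>, and each endpoint contributes an error below \<epsilon>; the
    total \<open>4 * \<epsilon>\<close> is to equal \<delta>.\<close>
  define \<epsilon> where "\<epsilon> = \<delta> / 4"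
  define K where "K = nat \<lceil>1 / (\<delta> * \<epsilon>)\<rceil>"
  have \<epsilon>: "\<epsilon> > 0"
    using \<delta> by (simp add: \<epsilon>_def)
  have lim: "(\<lambda>n. pair_corr x n s) \<longlonglongrightarrow> 2 * s" if "s \<ge> 0" for s
    using ppc that by (cases "s = 0") (auto simp: poissonian_pair_correlations_def pair_corr_0)
  \<comment> \<open>The cell containing \<open>n * r\<close> has a left endpoint of index at most
    \<open>K\<close>, so its right endpoint may have index \<open>Suc K\<close>.\<close>
  have "\<forall>\<^sub>F n in sequentially. \<forall>k\<in>{..Suc K}. dist (pair_corr x n (real k * \<epsilon>)) (2 * (real k * \<epsilon>)) < \<epsilon>"
    using \<epsilon> lim by (intro eventually_ball_finite ballI tendstoD) auto
  then show ?thesis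
    using eventually_ge_at_top[of 2]
  proof eventually_elim
    case (elim n)
    show ?case
    proof
      fix r
      define m where "m = card {j \<in> {1..n}. gap x n (\<sigma> n) j = r}"
      show "real m \<le> \<delta> * real n"
      proof (rule ccontr)
        assume "\<not> real m \<le> \<delta> * real n"
        then have large: "\<delta> * real n < real m" by simp
        moreover have "0 \<le> \<delta> * real n"
          using \<delta> by simp
        \<comment> \<open>Here \<open>r\<close> is an arbitrary real; since \<open>m\<close> is
          nonzero, it is a genuine gap length and hence nonnegative.\<close>
        ultimately have "m \<noteq> 0" by linarith
        then have "{j \<in> {1..n}. gap x n (\<sigma> n) j = r} \<noteq> {}"
          unfolding m_def by (metis card.empty)
        then have r: "r \<ge> 0"
          using gap_nonneg by blast
        define k where "k = nat \<lfloor>real n * r / \<epsilon>\<rfloor>"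
        have "real k \<le> real n * r / \<epsilon>" "real n * r / \<epsilon> < real k + 1"
          using r \<epsilon> by (auto simp: k_def)
        then have k: "real k * \<epsilon> \<le> real n * r" "real n * r < real (Suc k) * \<epsilon>"
          using \<epsilon> by (simp_all add: field_simps)
        \<comment> \<open>This chains \<open>\<delta> * n * r \<le> m * r \<le> 1\<close>, the
          second inequality being the length of the circle.\<close>
        have "\<delta> * real n * r \<le> 1"
          using mult_right_mono[OF less_imp_le[OF large] r]
            card_equal_gaps_mult_le_1[of n x "\<sigma> n" r] range sort elim(2)
          unfolding m_def by force
        then have "real n * r / \<epsilon> \<le> 1 / (\<delta> * \<epsilon>)"
          using \<delta> \<epsilon> by (simp add: field_simps)
        also have "\<dots> \<le> real K"
          unfolding K_def by (rule real_nat_ceiling_ge)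
        finally have "k \<le> K"
          using \<open>real k \<le> real n * r / \<epsilon>\<close> by linarith
        then have close: "\<bar>pair_corr x n (real k * \<epsilon>) - 2 * (real k * \<epsilon>)\<bar> < \<epsilon>"
          "\<bar>pair_corr x n (real (Suc k) * \<epsilon>) - 2 * (real (Suc k) * \<epsilon>)\<bar> < \<epsilon>"
          using elim(1) unfolding dist_real_def by (auto simp del: of_nat_Suc)
        have "real (Suc k) * \<epsilon> = real k * \<epsilon> + \<epsilon>"
          by (simp add: algebra_simps)
        then have "pair_corr x n (real (Suc k) * \<epsilon>) - pair_corr x n (real k * \<epsilon>) \<le> 4 * \<epsilon>"
          using close by argo
        then have "real n * (pair_corr x n (real (Suc k) * \<epsilon>) - pair_corr x n (real k * \<epsilon>)) \<le> real n * \<delta>"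
          by (intro mult_left_mono) (auto simp: \<epsilon>_def)
        moreover have "real m
            \<le> real n * (pair_corr x n (real (Suc k) * \<epsilon>) - pair_corr x n (real k * \<epsilon>))"
          unfolding m_def using elim(2) sort k by (intro card_equal_gaps_le_pair_corr_diff) auto
        ultimately show False
          using large by (simp add: mult.commute)
      qed
    qed
  qed
qed

theorem theorem1p2:
  fixes x :: "nat \<Rightarrow> real" and \<sigma> :: "nat \<Rightarrow> nat \<Rightarrow> nat"
  assumes "\<And>n. n \<ge> 1 \<Longrightarrow> x n \<in> {0..<1}"
    and "poissonian_pair_correlations x"
    and "\<And>n. n \<ge> 2 \<Longrightarrow> sorting_perm x n (\<sigma> n)"
  shows "(\<lambda>n. real (Max (gap_count x n (\<sigma> n) ` {1..num_gap_lengths x n (\<sigma> n)})))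
           \<in> o(\<lambda>n. real n)
       \<and> \<not> (\<exists>(\<nu> :: nat \<Rightarrow> nat) (c :: real).
              strict_mono \<nu> \<and> (\<forall>t. \<nu> t \<ge> 2) \<and> c > 0 \<and>
              (\<forall>t. \<exists>i\<in>{1..num_gap_lengths x (\<nu> t) (\<sigma> (\<nu> t))}.
                 real (gap_count x (\<nu> t) (\<sigma> (\<nu> t)) i) \<ge> c * real (\<nu> t)))"
proof
  \<comment> \<open>Uniformity in \<open>r\<close> allows \<open>r\<close> to be the
    \<open>i\<close>-th gap length. No range for \<open>i\<close> is required, as any value of
    \<open>nth_gap_length\<close> is a possible \<open>r\<close>.\<close>
  have small: "\<forall>\<^sub>F n in sequentially. \<forall>i. real (gap_count x n (\<sigma> n) i) \<le> \<delta> * real n"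
    if "\<delta> > 0" for \<delta>
  proof -
    have "\<forall>\<^sub>F n in sequentially. \<forall>r. real (card {j \<in> {1..n}. gap x n (\<sigma> n) j = r}) \<le> \<delta> * real n"
      using assms that by (rule eventually_card_equal_gaps_le)
    then show ?thesis
      by eventually_elim (simp add: gap_count_def)
  qed
  show "(\<lambda>n. real (Max (gap_count x n (\<sigma> n) ` {1..num_gap_lengths x n (\<sigma> n)})))
           \<in> o(\<lambda>n. real n)"
  proof (rule landau_o.smallI)
    fix \<delta> :: real assume "\<delta> > 0"
    from small[OF this] eventually_ge_at_top[of 1]
    show "\<forall>\<^sub>F n in sequentially.
        norm (real (Max (gap_count x n (\<sigma> n) ` {1..num_gap_lengths x n (\<sigma> n)}))) \<le> \<delta> * norm (real n)"
    proof eventually_elim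
      case (elim n)
      have "Max (gap_count x n (\<sigma> n) ` {1..num_gap_lengths x n (\<sigma> n)})
          \<in> gap_count x n (\<sigma> n) ` {1..num_gap_lengths x n (\<sigma> n)}"
        using num_gap_lengths_pos[OF elim(2)] by (intro Max_in) auto
      then show ?case
        using elim(1) by auto
    qed
  qed
  show "\<not> (\<exists>(\<nu> :: nat \<Rightarrow> nat) (c :: real).
              strict_mono \<nu> \<and> (\<forall>t. \<nu> t \<ge> 2) \<and> c > 0 \<and>
              (\<forall>t. \<exists>i\<in>{1..num_gap_lengths x (\<nu> t) (\<sigma> (\<nu> t))}.
                 real (gap_count x (\<nu> t) (\<sigma> (\<nu> t)) i) \<ge> c * real (\<nu> t)))"
  proof clarify
    fix \<nu> :: "nat \<Rightarrow> nat" and c :: real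
    assume \<nu>: "strict_mono \<nu>" "\<forall>t. \<nu> t \<ge> 2" and c: "c > 0"
      and many: "\<forall>t. \<exists>i\<in>{1..num_gap_lengths x (\<nu> t) (\<sigma> (\<nu> t))}.
                   real (gap_count x (\<nu> t) (\<sigma> (\<nu> t)) i) \<ge> c * real (\<nu> t)"
    \<comment> \<open>A strictly increasing \<nu> tends to infinity, so the bound passes to the
      subsequence. Taking \<open>c / 2\<close> makes it contradict the lower bound
      \<open>c * \<nu> t\<close>, which is positive.\<close>
    have "\<forall>\<^sub>F t in sequentially. \<forall>i. real (gap_count x (\<nu> t) (\<sigma> (\<nu> t)) i) \<le> c / 2 * real (\<nu> t)"
      using eventually_compose_filterlim[OF small filterlim_subseq[OF \<nu>(1)], of "c / 2"] c by simp
    then obtain t where t: "\<forall>i. real (gap_count x (\<nu> t) (\<sigma> (\<nu> t)) i) \<le> c / 2 * real (\<nu> t)"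
      using eventually_happens'[OF sequentially_bot] by blast
    obtain i where "c * real (\<nu> t) \<le> real (gap_count x (\<nu> t) (\<sigma> (\<nu> t)) i)"
      using many by blast
    with t have "c * real (\<nu> t) \<le> c / 2 * real (\<nu> t)"
      using order_trans by blast
    moreover have "c * real (\<nu> t) > 0"
      using c \<nu>(2)[rule_format, of t] by simp
    ultimately show False by simp
  qed
qed

end
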